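(* Let $n\ge 2$. The image of the set of $n\times n$ alternating sign matrices under the Waldspurger transform $\mathbf{WT}$ is exactly the set of all $(n-1)\times(n-1)$ matrices $M$ such that all columns and rows of $M$ are UM vectors with maximums on the diagonal (i.e. for each $k$, the maximum entry of the $k$-th row and the maximum entry of the $k$-th column are attained at position $(k,k)$). Moreover, component-wise comparison of these matrices is the same order as the one defined on alternating sign matrices via monotone triangles: for all $n\times n$ alternating sign matrices $X,Y$, one has $\mathbf{WT}(X)_{i,j}\le\mathbf{WT}(Y)_{i,j}$ for all $i,j$ if and only if the monotone triangle of $X$ is component-wise less than or equal to that of $Y$.
   Context: An alternating sign matrix (ASM) is a square matrix with entries in $\{0,1,-1\}$ whose rows and columns each sum to $1$ and in which the nonzero entries of each row and column alternate in sign. An $n\times n$ matrix $M$ is sum-symmetric if its $i$-th row sum equals its $i$-th column sum for all $i$. For a sum-symmetric $n\times n$ matrix $M$ (in particular for any permutation matrix or ASM), $\mathbf{WT}(M)$ is the $(n-1)\times(n-1)$ matrix $$\mathbf{WT}(M)_{i,j}=\begin{cases}\sum_{a\le i,\ b>j}M_{a,b} & i\le j,\\ \sum_{a>i,\ b\le j}M_{a,b} & i\ge j\end{cases}$$ (the formulas agree for $i=j$). A UM vector (of length $n-1$) is any vector that appears as a column of $\mathbf{WT}(\pi)$ for some permutation matrix $\pi\in\mathfrak{S}_n$. The monotone triangle of an $n\times n$ ASM $X$ is the triangular array whose $k$-th row ($1\le k\le n$) lists, in increasing order, the $k$ positions of the $1$'s in the sum of the first $k$ rows of $X$ (this sum is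 a $0/1$ vector with exactly $k$ ones). The ASM lattice is the set of $n\times n$ ASMs ordered by component-wise comparison of the entries of their monotone triangles. *)

theory Defs
  imports "Jordan_Normal_Form.Matrix" "HOL-Combinatorics.Permutations"
begin

text \<open>Matrix and vector indices start at 0, so the mathematical indices \<open>1, \<dots>, n\<close> correspond to
  \<open>0, \<dots>, n - 1\<close>.\<close>

definition alternating_signs :: "int vec \<Rightarrow> bool" where
  "alternating_signs v \<longleftrightarrow>
     (\<forall>i k. i < k \<and> k < dim_vec v \<and> v $ i \<noteq> 0 \<and> v $ k \<noteq> 0 \<and> (\<forall>m. i < m \<and> m < k \<longrightarrow> v $ m = 0)
        \<longrightarrow> sgn (v $ k) = - sgn (v $ i))"

definition asm_vec :: "int vec \<Rightarrow> bool" where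
  "asm_vec v \<longleftrightarrow>
     (\<forall>i<dim_vec v. v $ i \<in> {0, 1, -1}) \<and> (\<Sum>i<dim_vec v. v $ i) = 1 \<and> alternating_signs v"

definition ASMs :: "nat \<Rightarrow> int mat set" where
  "ASMs n = {X \<in> carrier_mat n n. (\<forall>i<n. asm_vec (row X i)) \<and> (\<forall>j<n. asm_vec (col X j))}"

definition permutation_matrices :: "nat \<Rightarrow> int mat set" where
  "permutation_matrices n =
     {mat n n (\<lambda>(i, j). if p i = j then 1 else 0) | p. p permutes {..<n}}"

definition sum_symmetric :: "int mat \<Rightarrow> bool" where
  "sum_symmetric M \<longleftrightarrow> square_mat M \<and>
     (\<forall>i<dim_row M. (\<Sum>j<dim_row M. M $$ (i, j)) = (\<Sum>j<dim_row M. M $$ (j, i)))"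

text \<open>Only meaningful for sum-symmetric arguments, where both branches agree for \<open>i = j\<close>
  (lemma \<open>WT_diagonal\<close> below).\<close>

definition WT :: "int mat \<Rightarrow> int mat" where
  "WT M = (let n = dim_row M in
     mat (n - 1) (n - 1) (\<lambda>(i, j).
       if i \<le> j then \<Sum>a\<le>i. \<Sum>b\<in>{j<..<n}. M $$ (a, b)
       else \<Sum>a\<in>{i<..<n}. \<Sum>b\<le>j. M $$ (a, b)))"

lemma WT_diagonal:
  assumes "sum_symmetric M" and "i < dim_row M - 1"
  shows "(\<Sum>a\<le>i. \<Sum>b\<in>{i<..<dim_row M}. M $$ (a, b)) = (\<Sum>a\<in>{i<..<dim_row M}. \<Sum>b\<le>i. M $$ (a, b))"
proof -
  let ?n = "dim_row M"
  have U: "{..<?n} = {..i} \<union> {i<..<?n}" using assms(2) by auto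
  have split: "(\<Sum>j<?n. f j) = (\<Sum>j\<le>i. f j) + (\<Sum>j\<in>{i<..<?n}. f j)" for f :: "nat \<Rightarrow> int"
    unfolding U by (rule sum.union_disjoint) auto
  have "(\<Sum>a\<le>i. \<Sum>j<?n. M $$ (a, j)) = (\<Sum>a\<le>i. \<Sum>j<?n. M $$ (j, a))"
    by (rule sum.cong[OF refl]) (use assms in \<open>auto simp: sum_symmetric_def\<close>)
  then have "(\<Sum>a\<le>i. \<Sum>b\<le>i. M $$ (a, b)) + (\<Sum>a\<le>i. \<Sum>b\<in>{i<..<?n}. M $$ (a, b)) =
      (\<Sum>a\<le>i. \<Sum>b\<le>i. M $$ (b, a)) + (\<Sum>a\<le>i. \<Sum>b\<in>{i<..<?n}. M $$ (b, a))"
    by (simp add: split sum.distrib)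
  moreover have "(\<Sum>a\<le>i. \<Sum>b\<le>i. M $$ (b, a)) = (\<Sum>a\<le>i. \<Sum>b\<le>i. M $$ (a, b))"
    by (rule sum.swap)
  moreover have "(\<Sum>a\<le>i. \<Sum>b\<in>{i<..<?n}. M $$ (b, a)) = (\<Sum>a\<in>{i<..<?n}. \<Sum>b\<le>i. M $$ (a, b))"
    by (rule sum.swap)
  ultimately show ?thesis by simp
qed

lemma sum_symmetric_ASM:
  assumes "X \<in> ASMs n" shows "sum_symmetric X"
  using assms by (auto simp: ASMs_def sum_symmetric_def asm_vec_def)

definition UM_vectors :: "nat \<Rightarrow> int vec set" where
  "UM_vectors n = {col (WT P) j | P j. P \<in> permutation_matrices n \<and> j < n - 1}"

text \<open>The positions in the rows of a monotone triangle are counted from 1, as usual.\<close>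

definition monotone_triangle :: "int mat \<Rightarrow> nat list list" where
  "monotone_triangle X =
     map (\<lambda>k. sorted_list_of_set {Suc j | j. j < dim_col X \<and> (\<Sum>a<k. X $$ (a, j)) = 1})
       [1..<Suc (dim_row X)]"

definition monotone_triangle_le :: "int mat \<Rightarrow> int mat \<Rightarrow> bool" where
  "monotone_triangle_le X Y \<longleftrightarrow>
     list_all2 (list_all2 (\<le>)) (monotone_triangle X) (monotone_triangle Y)"

end

theory Submission
  imports Defs
begin

text \<open>Everything is read off the corner sums \<open>c i j\<close>, the sums of the entries of the top left
  \<open>i \<times> j\<close> blocks of a matrix. A vector has the alternating sign property with total \<open>1\<close> exactly
  if its partial sums lie in \<open>{0, 1}\<close> and end in \<open>1\<close> (\<open>asm_vec_iff_partial_sums\<close>). Hence corner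
  sums identify the alternating sign matrices of size \<open>n\<close> with the functions \<open>c\<close> on
  \<open>{0..n} \<times> {0..n}\<close> that have the boundary values of a corner sum function and grow by \<open>0\<close> or
  \<open>1\<close> in each unit step (\<open>ASMs_iff_corner_sum_function\<close>, \<open>ASM_with_corner_sums\<close>).

  The transform is an affine image of the corner sums: with indices counted from 1,
  \<open>WT(X)(i, j) = min i j - c i j\<close>, and this formula gives \<open>0\<close> on the border where \<open>i\<close> or \<open>j\<close> is
  \<open>0\<close> or \<open>n\<close> (\<open>zero_border_WT\<close>). Subtracting the steps of \<open>c\<close> from those of \<open>min i p\<close> turns steps in
  \<open>{0, 1}\<close> into steps in \<open>{0, 1}\<close> before position \<open>p\<close> and in \<open>{0, -1}\<close> after it, so \<open>WT\<close> maps
  the alternating sign matrices onto the matrices whose \<open>p\<close>-th row and column, extended by zeros,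
  rise by \<open>0\<close> or \<open>1\<close> until position \<open>p\<close> and then fall by \<open>0\<close> or \<open>1\<close> (\<open>WT_image_iff\<close>). The UM
  vectors are the vectors that do this for some peak \<open>p\<close>: the positions where \<open>c\<close> grows form a set
  of size \<open>p\<close>, and some permutation sends exactly this set to the first \<open>p\<close> values
  (\<open>UM_vectors_iff\<close>). Such a vector is constant between two places where it is maximal, so its peak
  can be moved to any of them, which is how the condition on the diagonal enters
  (\<open>UM_with_maximum_iff\<close>).

  For the order, larger \<open>WT\<close> means smaller corner sums, and \<open>c k t\<close> counts the entries of the
  \<open>k\<close>-th row of the monotone triangle that are at most \<open>t\<close>. Two increasing sequences of equal length
  are compared entry by entry in the direction opposite to these counts
  (\<open>sorted_list_of_set_le_iff_card\<close>).\<close>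

section \<open>Corner sums of alternating sign matrices\<close>

definition corner_sum :: "int mat \<Rightarrow> nat \<Rightarrow> nat \<Rightarrow> int" where
  "corner_sum X i j = (\<Sum>a<i. \<Sum>b<j. X $$ (a, b))"

lemma corner_sum_swap: "corner_sum X i j = (\<Sum>b<j. \<Sum>a<i. X $$ (a, b))"
  unfolding corner_sum_def by (rule sum.swap)

lemma corner_sum_row_step: "corner_sum X (Suc i) j - corner_sum X i j = (\<Sum>b<j. X $$ (i, b))"
  by (simp add: corner_sum_def)

lemma corner_sum_col_step: "corner_sum X i (Suc j) - corner_sum X i j = (\<Sum>a<i. X $$ (a, j))"
  by (simp add: corner_sum_swap)

text \<open>Because signs alternate, the partial sums telescope to half the sum of the first and the most
  recent nonzero entry: they return to \<open>0\<close> whenever the most recent sign differs from the first.\<close>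

lemma alternating_partial_sums:
  assumes v: "\<forall>i<dim_vec v. v $ i \<in> {0, 1, -1}" and alt: "alternating_signs v"
    and first: "f < dim_vec v" "v $ f \<noteq> 0" "\<forall>m<f. v $ m = 0"
    and "f < k" "k \<le> dim_vec v"
  shows "\<exists>i<k. v $ i \<noteq> 0 \<and> (\<forall>m. i < m \<and> m < k \<longrightarrow> v $ m = 0)
           \<and> 2 * (\<Sum>i<k. v $ i) = v $ f + v $ i"
  using assms(6,7)
proof (induction k)
  case 0
  then show ?case by simp
next
  case (Suc k)
  show ?case
  proof (cases "f = k")
    case True
    have "(\<Sum>i<k. v $ i) = 0" using first(3) True by simp
    then show ?thesis using True first(2) by (intro exI[of _ k]) auto
  next
    case False
    then obtain i where i: "i < k" "v $ i \<noteq> 0" "\<forall>m. i < m \<and> m < k \<longrightarrow> v $ m = 0"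
        "2 * (\<Sum>i<k. v $ i) = v $ f + v $ i"
      using Suc by auto
    show ?thesis
    proof (cases "v $ k = 0")
      case True
      then show ?thesis using i by (intro exI[of _ i]) (auto simp: less_Suc_eq)
    next
      case False
      have "sgn (v $ k) = - sgn (v $ i)"
        using alt i False Suc.prems unfolding alternating_signs_def by auto
      moreover have "k < dim_vec v" "i < dim_vec v" using i(1) Suc.prems by auto
      then have "v $ k \<in> {0, 1, -1}" "v $ i \<in> {0, 1, -1}" using v by blast+
      ultimately have "v $ k = - v $ i" by auto
      then show ?thesis using i False by (intro exI[of _ k]) auto
    qed
  qed
qed

lemma asm_vec_iff_partial_sums:
  "asm_vec v \<longleftrightarrow> (\<forall>k\<le>dim_vec v. (\<Sum>i<k. v $ i) \<in> {0, 1}) \<and> (\<Sum>i<dim_vec v. v $ i) = 1"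
  (is "_ \<longleftrightarrow> ?P \<and> ?T")
proof (rule iffI)
  assume A: "asm_vec v"
  then have v: "\<forall>i<dim_vec v. v $ i \<in> {0, 1, -1}" and T: ?T and alt: "alternating_signs v"
    by (auto simp: asm_vec_def)
  have "\<exists>m. m < dim_vec v \<and> v $ m \<noteq> 0"
    using T by (metis lessThan_iff sum.neutral zero_neq_one)
  then obtain f where f: "f < dim_vec v" "v $ f \<noteq> 0" and "\<forall>m<f. \<not> (m < dim_vec v \<and> v $ m \<noteq> 0)"
    unfolding exists_least_iff[of "\<lambda>m. m < dim_vec v \<and> v $ m \<noteq> 0"] by blast
  then have f0: "\<forall>m<f. v $ m = 0" by auto
  note ps = alternating_partial_sums[OF v alt f f0]
  \<comment> \<open>The total \<open>1\<close> is half the sum of the first and the last nonzero entry, so both are \<open>1\<close>.\<close>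
  have "v $ f = 1"
  proof -
    from ps[of "dim_vec v"] f obtain i where "i < dim_vec v" "2 = v $ f + v $ i"
      using T by auto
    moreover then have "v $ i \<in> {0,1,-1}" "v $ f \<in> {0,1,-1}" using v f by blast+
    ultimately show ?thesis by auto
  qed
  moreover have "(\<Sum>i<k. v $ i) \<in> {0, 1}" if k: "k \<le> dim_vec v" for k
  proof (cases "f < k")
    case True
    from ps[OF True k] obtain i where "i < k" "2 * (\<Sum>i<k. v $ i) = v $ f + v $ i" by auto
    moreover then have "v $ i \<in> {0,1,-1}" using v k by (meson less_le_trans)
    ultimately show ?thesis using \<open>v $ f = 1\<close> by auto
  next
    case False
    then show ?thesis using f0 by simp
  qed
  ultimately show "?P \<and> ?T" using T by blast
next
  assume A: "?P \<and> ?T"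
  have s: "(\<Sum>i<k. v $ i) \<in> {0, 1}" if "k \<le> dim_vec v" for k using A that by blast
  have e: "v $ i = (\<Sum>i<Suc i. v $ i) - (\<Sum>i<i. v $ i)" for i by simp
  have "v $ i \<in> {0, 1, -1}" if "i < dim_vec v" for i
    using s[of i] s[of "Suc i"] that by auto
  moreover have "alternating_signs v"
    unfolding alternating_signs_def
  proof (intro allI impI, elim conjE)
    fix i k
    assume h: "i < k" "k < dim_vec v" "v $ i \<noteq> 0" "v $ k \<noteq> 0" "\<forall>m. i < m \<and> m < k \<longrightarrow> v $ m = 0"
    have "{..<k} = {..<Suc i} \<union> {Suc i..<k}" using h by auto
    \<comment> \<open>The sum after a nonzero entry \<open>v $ i\<close> is \<open>1\<close> or \<open>0\<close> according to its sign and persists up to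
      position \<open>k\<close>, where only the opposite sign keeps it in \<open>{0, 1}\<close>.\<close>
    then have "(\<Sum>m<k. v $ m) = (\<Sum>m<Suc i. v $ m) + (\<Sum>m\<in>{Suc i..<k}. v $ m)"
      by (metis finite_atLeastLessThan finite_lessThan ivl_disj_int_one(2) sum.union_disjoint)
    also have "(\<Sum>m\<in>{Suc i..<k}. v $ m) = 0" using h by (intro sum.neutral) auto
    finally have "(\<Sum>m<k. v $ m) = (\<Sum>m<i. v $ m) + v $ i" by simp
    then show "sgn (v $ k) = - sgn (v $ i)"
      using s[of i] s[of "Suc k"] s[of k] h by auto
  qed
  ultimately show "asm_vec v" using A by (simp add: asm_vec_def)
qed

definition corner_sum_function :: "nat \<Rightarrow> (nat \<Rightarrow> nat \<Rightarrow> int) \<Rightarrow> bool" where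
  "corner_sum_function n c \<longleftrightarrow>
     (\<forall>i\<le>n. c i 0 = 0 \<and> c 0 i = 0 \<and> c i n = int i \<and> c n i = int i) \<and>
     (\<forall>i<n. \<forall>j\<le>n. c (Suc i) j - c i j \<in> {0, 1}) \<and>
     (\<forall>i\<le>n. \<forall>j<n. c i (Suc j) - c i j \<in> {0, 1})"

lemma sum_eq_int:
  fixes f :: "nat \<Rightarrow> int"
  assumes "f 0 = 0"
  shows "(\<forall>i\<le>n. f i = int i) \<longleftrightarrow> (\<forall>i<n. f (Suc i) - f i = 1)"
proof
  assume R: "\<forall>i<n. f (Suc i) - f i = 1"
  have "i \<le> n \<longrightarrow> f i = int i" for i
    by (induction i) (use assms R in \<open>auto simp: algebra_simps Suc_le_eq\<close>)
  then show "\<forall>i\<le>n. f i = int i" by blast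
qed auto

lemma ASMs_iff_corner_sum_function:
  assumes "X \<in> carrier_mat n n"
  shows "X \<in> ASMs n \<longleftrightarrow> corner_sum_function n (corner_sum X)"
proof -
  have dims: "dim_row X = n" "dim_col X = n" using assms by auto
  have r: "asm_vec (row X i) \<longleftrightarrow> (\<forall>j\<le>n. corner_sum X (Suc i) j - corner_sum X i j \<in> {0, 1})
      \<and> corner_sum X (Suc i) n - corner_sum X i n = 1" if "i < n" for i
    unfolding asm_vec_iff_partial_sums corner_sum_row_step using that by (auto simp: dims)
  have c: "asm_vec (col X j) \<longleftrightarrow> (\<forall>i\<le>n. corner_sum X i (Suc j) - corner_sum X i j \<in> {0, 1})
      \<and> corner_sum X n (Suc j) - corner_sum X n j = 1" if "j < n" for j
    unfolding asm_vec_iff_partial_sums corner_sum_col_step using that by (auto simp: dims)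
  have z: "corner_sum X i 0 = 0" "corner_sum X 0 i = 0" for i by (auto simp: corner_sum_def)
  have "(\<forall>i\<le>n. corner_sum X i n = int i) \<longleftrightarrow>
      (\<forall>i<n. corner_sum X (Suc i) n - corner_sum X i n = 1)"
    by (rule sum_eq_int) (rule z)
  moreover have "(\<forall>i\<le>n. corner_sum X n i = int i) \<longleftrightarrow>
      (\<forall>i<n. corner_sum X n (Suc i) - corner_sum X n i = 1)"
    by (rule sum_eq_int) (rule z)
  ultimately show ?thesis
    using assms r c z unfolding ASMs_def corner_sum_function_def by simp blast
qed

text \<open>The matrix is the mixed second difference of \<open>c\<close>; summing it over a corner block telescopes
  in both directions.\<close>

lemma ASM_with_corner_sums:
  assumes c: "corner_sum_function n c"
  obtains X where "X \<in> ASMs n" "\<And>i j. i \<le> n \<Longrightarrow> j \<le> n \<Longrightarrow> corner_sum X i j = c i j"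
proof -
  define X where
    "X = mat n n (\<lambda>(i, j). (c (Suc i) (Suc j) - c i (Suc j)) - (c (Suc i) j - c i j))"
  have eq: "corner_sum X i j = c i j" if "i \<le> n" "j \<le> n" for i j
  proof -
    have "corner_sum X i j =
        (\<Sum>a<i. \<Sum>b<j. (c (Suc a) (Suc b) - c a (Suc b)) - (c (Suc a) b - c a b))"
      unfolding corner_sum_def X_def using that by (intro sum.cong refl) auto
    also have "\<dots> = (\<Sum>a<i. (c (Suc a) j - c a j) - (c (Suc a) 0 - c a 0))"
      by (subst sum_lessThan_telescope) simp
    also have "\<dots> = (\<Sum>a<i. c (Suc a) j - c a j)"
      using c that unfolding corner_sum_function_def by (intro sum.cong refl) auto
    also have "\<dots> = c i j - c 0 j" by (rule sum_lessThan_telescope)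
    finally show ?thesis using c that unfolding corner_sum_function_def by auto
  qed
  have X: "X \<in> carrier_mat n n" by (simp add: X_def)
  have "corner_sum_function n (corner_sum X)"
    using c unfolding corner_sum_function_def by (simp add: eq)
  then show ?thesis using that eq ASMs_iff_corner_sum_function[OF X] by blast
qed

section \<open>The transform in terms of corner sums\<close>

text \<open>The transform is a matrix on the interior points of the grid \<open>{0..n} \<times> {0..n}\<close>; extending it by
  zero lets the corner sums and the transform be compared without exceptional cases at the edges.
  Index \<open>(i, j)\<close> here is the matrix index \<open>(i - 1, j - 1)\<close>.\<close>

definition zero_border :: "nat \<Rightarrow> int mat \<Rightarrow> nat \<Rightarrow> nat \<Rightarrow> int" where
  "zero_border n M i j = (if 0 < i \<and> i < n \<and> 0 < j \<and> j < n then M $$ (i - 1, j - 1) else 0)"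

lemma sum_split_at:
  fixes f :: "nat \<Rightarrow> int"
  assumes "j < n"
  shows "(\<Sum>b<n. f b) = (\<Sum>b<Suc j. f b) + (\<Sum>b\<in>{j<..<n}. f b)"
proof -
  have U: "{..<n} = {..<Suc j} \<union> {j<..<n}" using assms by auto
  show ?thesis unfolding U by (rule sum.union_disjoint) auto
qed

lemma WT_carrier: "X \<in> ASMs n \<Longrightarrow> WT X \<in> carrier_mat (n - 1) (n - 1)"
  by (auto simp: WT_def ASMs_def Let_def)

text \<open>Completing either sum that defines \<open>WT\<close> by the corner block gives full rows above the diagonal and
  full columns below it, whose total is the number of these rows or columns. As \<open>j\<close> counts from
  \<open>0\<close>, the condition \<open>b > j\<close> leaves out the first \<open>Suc j\<close> columns.\<close>

lemma WT_corner_sum: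
  assumes X: "X \<in> ASMs n" and ij: "i < n - 1" "j < n - 1"
  shows "WT X $$ (i, j) = int (min (Suc i) (Suc j)) - corner_sum X (Suc i) (Suc j)"
proof -
  have car: "X \<in> carrier_mat n n" using X by (simp add: ASMs_def)
  then have c: "corner_sum_function n (corner_sum X)" using X ASMs_iff_corner_sum_function by blast
  have d: "dim_row X = n" using car by simp
  have R: "(\<Sum>a\<le>i. \<Sum>b\<in>{j<..<n}. X $$ (a, b)) = corner_sum X (Suc i) n - corner_sum X (Suc i) (Suc j)"
    using ij sum_split_at[of j n] by (simp add: corner_sum_def lessThan_Suc_atMost sum.distrib)
  have C: "(\<Sum>a\<in>{i<..<n}. \<Sum>b\<le>j. X $$ (a, b)) = corner_sum X n (Suc j) - corner_sum X (Suc i) (Suc j)"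
    using ij sum_split_at[of i n] by (simp add: corner_sum_def lessThan_Suc_atMost)
  have "corner_sum X (Suc i) n = int (Suc i)" "corner_sum X n (Suc j) = int (Suc j)"
    using c ij unfolding corner_sum_function_def by auto
  then show ?thesis using ij by (simp add: WT_def Let_def d R C min_def del: of_nat_Suc)
qed

lemma zero_border_WT:
  assumes X: "X \<in> ASMs n" and ij: "i \<le> n" "j \<le> n"
  shows "zero_border n (WT X) i j = int (min i j) - corner_sum X i j"
proof -
  have c: "corner_sum_function n (corner_sum X)"
    using X ASMs_iff_corner_sum_function by (auto simp: ASMs_def)
  consider "0 < i \<and> i < n \<and> 0 < j \<and> j < n" | "i = 0" | "j = 0" | "i = n" | "j = n"
    using ij by linarith
  then show ?thesis
  proof cases
    case 1
    then have "i - 1 < n - 1" "j - 1 < n - 1" by auto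
    from WT_corner_sum[OF X this] 1 show ?thesis by (simp add: zero_border_def)
  qed (use c ij in \<open>auto simp: zero_border_def corner_sum_function_def\<close>)
qed

section \<open>UM vectors\<close>

text \<open>The sequence is a lattice path from \<open>0\<close> at time \<open>0\<close> to \<open>0\<close> at time \<open>n\<close> whose
  steps have size at most \<open>1\<close>, never go down before time \<open>p\<close> and never go up after it.\<close>

definition unimodal_steps :: "nat \<Rightarrow> nat \<Rightarrow> (nat \<Rightarrow> int) \<Rightarrow> bool" where
  "unimodal_steps n p w \<longleftrightarrow> w 0 = 0 \<and> w n = 0 \<and>
     (\<forall>i<p. w (Suc i) - w i \<in> {0, 1}) \<and> (\<forall>i. p \<le> i \<and> i < n \<longrightarrow> w i - w (Suc i) \<in> {0, 1})"

lemma all_less_split: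
  fixes p n :: nat
  assumes "p \<le> n" "\<And>i. i < p \<Longrightarrow> C i \<longleftrightarrow> A i" "\<And>i. \<not> i < p \<Longrightarrow> C i \<longleftrightarrow> B i"
  shows "(\<forall>i<n. C i) \<longleftrightarrow> (\<forall>i<p. A i) \<and> (\<forall>i. p \<le> i \<and> i < n \<longrightarrow> B i)"
proof -
  have "C i \<longleftrightarrow> (if i < p then A i else B i)" for i using assms by auto
  then show ?thesis using assms(1) by auto
qed

text \<open>As a function of \<open>i\<close>, the number \<open>min i p\<close> grows by \<open>1\<close> before \<open>p\<close> and is constant
  afterwards. Subtracting steps in \<open>{0, 1}\<close> from it therefore leaves steps in \<open>{0, 1}\<close> before \<open>p\<close>
  and in \<open>{0, -1}\<close> after it.\<close>

lemma corner_sum_function_iff_unimodal: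
  "corner_sum_function n (\<lambda>i j. int (min i j) - w i j) \<longleftrightarrow>
     (\<forall>p\<le>n. w 0 p = 0 \<and> w n p = 0 \<and> w p 0 = 0 \<and> w p n = 0) \<and>
     (\<forall>p\<le>n. unimodal_steps n p (\<lambda>i. w i p) \<and> unimodal_steps n p (\<lambda>i. w p i))"
  (is "corner_sum_function n ?c \<longleftrightarrow> _")
proof -
  have r: "i < p \<Longrightarrow> ?c (Suc i) p - ?c i p \<in> {0,1} \<longleftrightarrow> w (Suc i) p - w i p \<in> {0,1}"
    "\<not> i < p \<Longrightarrow> ?c (Suc i) p - ?c i p \<in> {0,1} \<longleftrightarrow> w i p - w (Suc i) p \<in> {0,1}"
    "i < p \<Longrightarrow> ?c p (Suc i) - ?c p i \<in> {0,1} \<longleftrightarrow> w p (Suc i) - w p i \<in> {0,1}"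
    "\<not> i < p \<Longrightarrow> ?c p (Suc i) - ?c p i \<in> {0,1} \<longleftrightarrow> w p i - w p (Suc i) \<in> {0,1}" for i p
    by (auto simp: min_def)
  have b: "(\<forall>i\<le>n. ?c i 0 = 0 \<and> ?c 0 i = 0 \<and> ?c i n = int i \<and> ?c n i = int i)
     \<longleftrightarrow> (\<forall>p\<le>n. w 0 p = 0 \<and> w n p = 0 \<and> w p 0 = 0 \<and> w p n = 0)"
    by (auto simp: min_def)
  have u: "unimodal_steps n p (\<lambda>i. w i p) \<longleftrightarrow> w 0 p = 0 \<and> w n p = 0 \<and>
      (\<forall>i<n. ?c (Suc i) p - ?c i p \<in> {0,1})"
    "unimodal_steps n p (\<lambda>i. w p i) \<longleftrightarrow> w p 0 = 0 \<and> w p n = 0 \<and>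
      (\<forall>i<n. ?c p (Suc i) - ?c p i \<in> {0,1})"
    if "p \<le> n" for p
    unfolding unimodal_steps_def
    by (subst all_less_split[OF that r(1) r(2)] all_less_split[OF that r(3) r(4)]; simp)+
  have "(\<forall>p\<le>n. unimodal_steps n p (\<lambda>i. w i p) \<and> unimodal_steps n p (\<lambda>i. w p i)) \<longleftrightarrow>
      (\<forall>p\<le>n. w 0 p = 0 \<and> w n p = 0 \<and> w p 0 = 0 \<and> w p n = 0) \<and>
      (\<forall>p\<le>n. \<forall>i<n. ?c (Suc i) p - ?c i p \<in> {0,1}) \<and>
      (\<forall>p\<le>n. \<forall>i<n. ?c p (Suc i) - ?c p i \<in> {0,1})"
    using u by auto
  then show ?thesis
    unfolding corner_sum_function_def b by auto
qed

lemma unimodal_steps_increasing: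
  assumes w: "unimodal_steps n p w" and "i \<le> j" "j \<le> p"
  shows "w i \<le> w j"
  using assms(2,3)
proof (induction rule: dec_induct)
  case (step m)
  then have "w (Suc m) - w m \<in> {0,1}" using w unfolding unimodal_steps_def by auto
  then show ?case using step by auto
qed simp

lemma unimodal_steps_decreasing:
  assumes w: "unimodal_steps n p w" and "i \<le> j" "p \<le> i" "j \<le> n"
  shows "w j \<le> w i"
  using assms(2-)
proof (induction rule: dec_induct)
  case (step m)
  then have "w m - w (Suc m) \<in> {0,1}" using w unfolding unimodal_steps_def by auto
  then show ?case using step by auto
qed simp

text \<open>The sequence is monotone between the peak \<open>p\<close> and the other maximal position \<open>q\<close>, hence constant
  there, and zero steps are allowed on both sides of a peak.\<close>

lemma unimodal_steps_at_maximum: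
  assumes w: "unimodal_steps n p w" and "p \<le> n" "q \<le> n" and le: "w p \<le> w q"
  shows "unimodal_steps n q w"
proof -
  note up = unimodal_steps_increasing[OF w] and down = unimodal_steps_decreasing[OF w]
  have flat1: "w (Suc i) = w i" if "q \<le> i" "i < p" for i
    using up[of q i] up[of i "Suc i"] up[of "Suc i" p] that le by simp
  have flat2: "w (Suc i) = w i" if "p \<le> i" "i < q" for i
    using down[of p i] down[of i "Suc i"] down[of "Suc i" q] that le assms(3) by simp
  show ?thesis
    unfolding unimodal_steps_def
  proof (intro conjI allI impI)
    fix i assume "i < q"
    then show "w (Suc i) - w i \<in> {0, 1}"
      using w flat2[of i] unfolding unimodal_steps_def by (cases "i < p") auto
  next
    fix i assume "q \<le> i \<and> i < n"
    then show "w i - w (Suc i) \<in> {0, 1}"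
      using w flat1[of i] unfolding unimodal_steps_def by (cases "i < p") auto
  qed (use w in \<open>auto simp: unimodal_steps_def\<close>)
qed

lemma permutation_with_preimage:
  assumes "S \<subseteq> {..<n}" "card S = p"
  obtains \<pi> where "\<pi> permutes {..<n}" "\<And>a. a < n \<Longrightarrow> \<pi> a < p \<longleftrightarrow> a \<in> S"
proof -
  have fS: "finite S" using assms finite_subset by blast
  have pn: "p \<le> n" using assms card_mono[of "{..<n}" S] by simp
  obtain f where f: "bij_betw f S {..<p}"
    using finite_same_card_bij[OF fS, of "{..<p}"] assms by auto
  have "card ({..<n} - S) = card {p..<n}" using assms fS by (simp add: card_Diff_subset)
  then obtain g where g: "bij_betw g ({..<n} - S) {p..<n}"
    using finite_same_card_bij[of "{..<n} - S" "{p..<n}"] by auto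
  define h where "h a = (if a \<in> S then f a else if a < n then g a else a)" for a
  have hf: "bij_betw h S {..<p}" using f by (rule bij_betw_cong[THEN iffD1, rotated]) (simp add: h_def)
  have hg: "bij_betw h ({..<n} - S) {p..<n}"
    using g by (rule bij_betw_cong[THEN iffD1, rotated]) (simp add: h_def)
  have "bij_betw h (S \<union> ({..<n} - S)) ({..<p} \<union> {p..<n})"
    by (rule bij_betw_combine[OF hf hg]) auto
  moreover have "S \<union> ({..<n} - S) = {..<n}" "{..<p} \<union> {p..<n} = {..<n}" using assms pn by auto
  ultimately have "bij_betw h {..<n} {..<n}" by simp
  then have "h permutes {..<n}"
    by (rule bij_imp_permutes) (use assms in \<open>auto simp: h_def\<close>)
  moreover have "h a < p \<longleftrightarrow> a \<in> S" if "a < n" for a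
    using bij_betwE[OF hf, rule_format, of a] bij_betwE[OF hg, rule_format, of a] that
    by (cases "a \<in> S") auto
  ultimately show ?thesis using that by blast
qed

text \<open>The partial sums of a row jump from \<open>0\<close> to \<open>1\<close> at \<open>\<pi> i\<close>, and those of a column at the preimage of
  its index.\<close>

lemma permutation_matrix_ASM:
  assumes "\<pi> permutes {..<n}"
  shows "mat n n (\<lambda>(i, j). if \<pi> i = j then 1 else 0) \<in> ASMs n" (is "?P \<in> _")
proof -
  have row: "asm_vec (row ?P i)" if i: "i < n" for i
  proof -
    have "(\<Sum>b<k. row ?P i $ b) = (if \<pi> i < k then 1 else 0)" if "k \<le> n" for k
    proof -
      have "(\<Sum>b<k. row ?P i $ b) = (\<Sum>b<k. if \<pi> i = b then 1 else 0)"
        using that i by (intro sum.cong) auto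
      then show ?thesis by simp
    qed
    then show ?thesis
      using permutes_in_image[OF assms, of i] i by (simp add: asm_vec_iff_partial_sums)
  qed
  have col: "asm_vec (col ?P j)" if j: "j < n" for j
  proof -
    define \<sigma> where "\<sigma> = inv_into UNIV \<pi>"
    have \<sigma>: "\<sigma> permutes {..<n}" "\<And>a. \<sigma> j = a \<longleftrightarrow> \<pi> a = j"
      unfolding \<sigma>_def using permutes_inv[OF assms] permutes_inv_eq[OF assms] by auto
    have "(\<Sum>a<k. col ?P j $ a) = (if \<sigma> j < k then 1 else 0)" if "k \<le> n" for k
    proof -
      have "(\<Sum>a<k. col ?P j $ a) = (\<Sum>a<k. if \<sigma> j = a then 1 else 0)"
        using that j \<sigma>(2) by (intro sum.cong) auto
      then show ?thesis by simp
    qed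
    then show ?thesis
      using permutes_in_image[OF \<sigma>(1), of j] j
      by (simp add: asm_vec_iff_partial_sums)
  qed
  show ?thesis using row col by (simp add: ASMs_def)
qed

definition zero_border_vec :: "nat \<Rightarrow> int vec \<Rightarrow> nat \<Rightarrow> int" where
  "zero_border_vec n u i = (if 0 < i \<and> i < n then u $ (i - 1) else 0)"

lemma ASM_WT_unimodal:
  assumes "X \<in> ASMs n" "p \<le> n"
  shows "unimodal_steps n p (\<lambda>i. zero_border n (WT X) i p)"
    and "unimodal_steps n p (\<lambda>i. zero_border n (WT X) p i)"
proof -
  have "corner_sum_function n (corner_sum X)"
    using assms ASMs_iff_corner_sum_function by (auto simp: ASMs_def)
  then have "corner_sum_function n (\<lambda>i j. int (min i j) - zero_border n (WT X) i j)"
    unfolding corner_sum_function_def by (simp add: zero_border_WT assms)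
  then show "unimodal_steps n p (\<lambda>i. zero_border n (WT X) i p)"
    and "unimodal_steps n p (\<lambda>i. zero_border n (WT X) p i)"
    using assms(2) unfolding corner_sum_function_iff_unimodal by auto
qed

lemma zero_border_vec_row_col:
  assumes "M \<in> carrier_mat (n - 1) (n - 1)" "0 < p" "p < n"
  shows "zero_border_vec n (col M (p - 1)) = (\<lambda>i. zero_border n M i p)"
    and "zero_border_vec n (row M (p - 1)) = (\<lambda>i. zero_border n M p i)"
  using assms by (auto simp: zero_border_vec_def zero_border_def fun_eq_iff)

text \<open>For the converse direction, read the corner sums \<open>min i p - w i\<close> off the path \<open>w\<close>. They
  grow at the rows in a set \<open>S\<close> of size \<open>p\<close>, and any permutation that maps exactly \<open>S\<close> to the first
  \<open>p\<close> values has them as the corner sums with column bound \<open>p\<close>.\<close>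

lemma UM_vectors_iff:
  "u \<in> UM_vectors n \<longleftrightarrow>
     dim_vec u = n - 1 \<and> (\<exists>p. 0 < p \<and> p < n \<and> unimodal_steps n p (zero_border_vec n u))"
proof (intro iffI conjI)
  assume "u \<in> UM_vectors n"
  then obtain P j where P: "P \<in> permutation_matrices n" and j: "j < n - 1" and u: "u = col (WT P) j"
    unfolding UM_vectors_def by blast
  have A: "P \<in> ASMs n" using P permutation_matrix_ASM unfolding permutation_matrices_def by blast
  have W: "WT P \<in> carrier_mat (n - 1) (n - 1)" using A by (rule WT_carrier)
  then show "dim_vec u = n - 1" using u by simp
  have "unimodal_steps n (Suc j) (zero_border_vec n u)"
    using ASM_WT_unimodal(1)[OF A, of "Suc j"] zero_border_vec_row_col(1)[OF W, of "Suc j"] j u by simp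
  then show "\<exists>p. 0 < p \<and> p < n \<and> unimodal_steps n p (zero_border_vec n u)"
    using j by (intro exI[of _ "Suc j"]) auto
next
  let ?w = "zero_border_vec n u"
  assume "dim_vec u = n - 1 \<and> (\<exists>p. 0 < p \<and> p < n \<and> unimodal_steps n p ?w)"
  then obtain p where d: "dim_vec u = n - 1" and p: "0 < p" "p < n" and w: "unimodal_steps n p ?w"
    by blast
  \<comment> \<open>\<open>S\<close> collects the rows where \<open>min i p - ?w i\<close> grows.\<close>
  define S where "S = {a. a < n \<and> (if a < p then ?w (Suc a) = ?w a else ?w (Suc a) \<noteq> ?w a)}"
  have count: "int (card (S \<inter> {..<i})) = int (min i p) - ?w i" if "i \<le> n" for i
    using that
  proof (induction i)
    case 0
    then show ?case using w by (simp add: unimodal_steps_def)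
  next
    case (Suc i)
    have "S \<inter> {..<Suc i} = (if i \<in> S then insert i (S \<inter> {..<i}) else S \<inter> {..<i})"
      by (auto simp: less_Suc_eq)
    then have "card (S \<inter> {..<Suc i}) = card (S \<inter> {..<i}) + (if i \<in> S then 1 else 0)" by simp
    moreover have "i < p \<Longrightarrow> ?w (Suc i) - ?w i \<in> {0, 1}" "\<not> i < p \<Longrightarrow> ?w i - ?w (Suc i) \<in> {0, 1}"
      using w Suc.prems unfolding unimodal_steps_def by auto
    ultimately show ?case using Suc by (cases "i < p") (auto simp: S_def)
  qed
  have Sn: "S \<subseteq> {..<n}" by (auto simp: S_def)
  moreover have "card S = p"
  proof -
    have "S \<inter> {..<n} = S" using Sn by auto
    then have "int (card S) = int (min n p) - ?w n" using count[of n] by simp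
    then show ?thesis using p w unfolding unimodal_steps_def by simp
  qed
  ultimately obtain \<pi> where \<pi>: "\<pi> permutes {..<n}" "\<And>a. a < n \<Longrightarrow> \<pi> a < p \<longleftrightarrow> a \<in> S"
    using permutation_with_preimage by blast
  define P where "P = mat n n (\<lambda>(i, j). if \<pi> i = j then 1 else 0 :: int)"
  have A: "P \<in> ASMs n" unfolding P_def using \<pi>(1) by (rule permutation_matrix_ASM)
  have cs: "corner_sum P i p = int (card (S \<inter> {..<i}))" if "i \<le> n" for i
  proof -
    have "corner_sum P i p = (\<Sum>a<i. \<Sum>b<p. if \<pi> a = b then 1 else 0)"
      unfolding corner_sum_def P_def using that p by (intro sum.cong refl) auto
    also have "\<dots> = (\<Sum>a<i. if a \<in> S then 1 else 0)"
      using that \<pi>(2) by (intro sum.cong refl) auto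
    also have "\<dots> = (\<Sum>a\<in>{..<i} \<inter> S. 1)" by (rule sum.inter_restrict[symmetric]) simp
    finally show ?thesis by (simp add: Int_commute)
  qed
  have W: "WT P \<in> carrier_mat (n - 1) (n - 1)" using A by (rule WT_carrier)
  have "u = col (WT P) (p - 1)"
  proof (rule eq_vecI)
    fix i assume "i < dim_vec (col (WT P) (p - 1))"
    then have i: "i < n - 1" using W by simp
    have "col (WT P) (p - 1) $ i = zero_border n (WT P) (Suc i) p"
      using i p W by (simp add: zero_border_def)
    also have "\<dots> = ?w (Suc i)"
      using zero_border_WT[OF A, of "Suc i" p] cs[of "Suc i"] count[of "Suc i"] i p by simp
    also have "\<dots> = u $ i" using i by (simp add: zero_border_vec_def)
    finally show "u $ i = col (WT P) (p - 1) $ i" ..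
  qed (use W d in simp)
  moreover have "P \<in> permutation_matrices n"
    unfolding permutation_matrices_def P_def using \<pi>(1) by blast
  moreover have "p - 1 < n - 1" using p by simp
  ultimately show "u \<in> UM_vectors n" unfolding UM_vectors_def by blast
qed

text \<open>A path with peak \<open>q\<close> is monotone on both sides of \<open>q\<close>, so it is maximal there; conversely, the
  peak of a path can be moved to any position with the maximal value. Position \<open>q\<close> of the path is
  the vector index \<open>q - 1\<close>.\<close>

lemma UM_with_maximum_iff:
  assumes q: "0 < q" "q < n" and d: "dim_vec u = n - 1"
  shows "u \<in> UM_vectors n \<and> (\<forall>i<n - 1. u $ i \<le> u $ (q - 1)) \<longleftrightarrow>
    unimodal_steps n q (zero_border_vec n u)"
proof
  let ?w = "zero_border_vec n u"
  assume A: "u \<in> UM_vectors n \<and> (\<forall>i<n - 1. u $ i \<le> u $ (q - 1))"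
  then obtain p where p: "0 < p" "p < n" and w: "unimodal_steps n p ?w"
    unfolding UM_vectors_iff by blast
  have "?w p \<le> ?w q" using A p q by (simp add: zero_border_vec_def)
  then show "unimodal_steps n q ?w"
    using unimodal_steps_at_maximum[OF w] p q by simp
next
  let ?w = "zero_border_vec n u"
  assume w: "unimodal_steps n q ?w"
  have "u $ i \<le> u $ (q - 1)" if i: "i < n - 1" for i
  proof -
    have "?w (Suc i) \<le> ?w q"
      using unimodal_steps_increasing[OF w, of "Suc i" q]
        unimodal_steps_decreasing[OF w, of q "Suc i"] i by linarith
    moreover have "Suc i < n" using i by simp
    ultimately show ?thesis using q by (simp add: zero_border_vec_def)
  qed
  then show "u \<in> UM_vectors n \<and> (\<forall>i<n - 1. u $ i \<le> u $ (q - 1))"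
    unfolding UM_vectors_iff using w q d by blast
qed

lemma WT_image_iff:
  "M \<in> WT ` ASMs n \<longleftrightarrow> M \<in> carrier_mat (n - 1) (n - 1) \<and>
     (\<forall>p. 0 < p \<and> p < n \<longrightarrow>
       unimodal_steps n p (\<lambda>i. zero_border n M i p) \<and> unimodal_steps n p (\<lambda>i. zero_border n M p i))"
  (is "_ \<longleftrightarrow> ?R")
proof
  assume "M \<in> WT ` ASMs n"
  then show ?R using WT_carrier ASM_WT_unimodal by auto
next
  assume R: ?R
  let ?c = "\<lambda>i j. int (min i j) - zero_border n M i j"
  have "unimodal_steps n p (\<lambda>i. zero_border n M i p) \<and> unimodal_steps n p (\<lambda>i. zero_border n M p i)"
    if "p \<le> n" for p
  proof (cases "0 < p \<and> p < n")
    case False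
    then have "p = 0 \<or> p = n" using that by auto
    then show ?thesis by (auto simp: zero_border_def unimodal_steps_def)
  qed (use R in blast)
  then have "corner_sum_function n ?c"
    unfolding corner_sum_function_iff_unimodal by (auto simp: zero_border_def)
  then obtain X where X: "X \<in> ASMs n" and
    c: "\<And>i j. i \<le> n \<Longrightarrow> j \<le> n \<Longrightarrow> corner_sum X i j = ?c i j"
    using ASM_with_corner_sums by blast
  have "WT X = M"
  proof (rule eq_matI)
    fix i j assume "i < dim_row M" "j < dim_col M"
    then have ij: "i < n - 1" "j < n - 1" using R by auto
    moreover from this have "Suc i < n" "Suc j < n" by auto
    ultimately show "WT X $$ (i, j) = M $$ (i, j)"
      using c[of "Suc i" "Suc j"] by (simp add: WT_corner_sum[OF X] zero_border_def)
  qed (use R WT_carrier[OF X] in auto)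
  then show "M \<in> WT ` ASMs n" using X by blast
qed

section \<open>Monotone triangles\<close>

lemma list_all2_le_length_filter:
  fixes xs ys :: "'a::linorder list"
  assumes "list_all2 (\<le>) xs ys"
  shows "length (filter (\<lambda>x. x \<le> t) ys) \<le> length (filter (\<lambda>x. x \<le> t) xs)"
  using assms by (induction rule: list_all2_induct) auto

text \<open>The \<open>m\<close>-th smallest element of \<open>B\<close> is an upper bound of \<open>m\<close> elements of \<open>B\<close>; if it bounds at
  least as many elements of \<open>A\<close>, then it bounds the \<open>m\<close>-th smallest element of \<open>A\<close>.\<close>

lemma sorted_list_of_set_le_iff_card:
  fixes A B :: "'a::linorder set"
  assumes fin: "finite A" "finite B" and card: "card A = card B"
  shows "list_all2 (\<le>) (sorted_list_of_set A) (sorted_list_of_set B) \<longleftrightarrow>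
    (\<forall>t. card (B \<inter> {..t}) \<le> card (A \<inter> {..t}))"
proof -
  have count: "card (S \<inter> {..t}) = length (filter (\<lambda>x. x \<le> t) (sorted_list_of_set S))"
    if "finite S" for S :: "'a set" and t
  proof -
    have "S \<inter> {..t} = set (filter (\<lambda>x. x \<le> t) (sorted_list_of_set S))" using that by auto
    then show ?thesis by (simp add: distinct_card del: set_filter)
  qed
  show ?thesis
  proof
    assume "list_all2 (\<le>) (sorted_list_of_set A) (sorted_list_of_set B)"
    then show "\<forall>t. card (B \<inter> {..t}) \<le> card (A \<inter> {..t})"
      using list_all2_le_length_filter by (simp add: count fin) blast
  next
    assume le: "\<forall>t. card (B \<inter> {..t}) \<le> card (A \<inter> {..t})"
    let ?xs = "sorted_list_of_set A" and ?ys = "sorted_list_of_set B"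
    \<comment> \<open>If \<open>?xs ! m\<close> were larger, at most \<open>m\<close> elements of \<open>A\<close>, but \<open>Suc m\<close> elements of \<open>B\<close> would be
      at most \<open>?ys ! m\<close>.\<close>
    have "?xs ! m \<le> ?ys ! m" if m: "m < card B" for m
    proof (rule ccontr)
      assume lt: "\<not> ?xs ! m \<le> ?ys ! m"
      have "(\<lambda>i. ?ys ! i) ` {..m} \<subseteq> B \<inter> {..?ys ! m}"
      proof clarify
        fix i assume "i \<le> m"
        then show "?ys ! i \<in> B \<inter> {..?ys ! m}"
          using m fin sorted_nth_mono[of ?ys i m] nth_mem[of i ?ys] by auto
      qed
      moreover have "inj_on (\<lambda>i. ?ys ! i) {..m}"
        using m by (intro inj_on_nth) auto
      ultimately have "Suc m \<le> card (B \<inter> {..?ys ! m})"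
        using card_inj_on_le[of "\<lambda>i. ?ys ! i" "{..m}"] fin by simp
      moreover have "A \<inter> {..?ys ! m} \<subseteq> (\<lambda>i. ?xs ! i) ` {..<m}"
      proof
        fix a assume a: "a \<in> A \<inter> {..?ys ! m}"
        then obtain i where i: "i < length ?xs" "a = ?xs ! i"
          using fin by (metis Int_iff in_set_conv_nth set_sorted_list_of_set)
        have "\<not> m \<le> i"
          using sorted_nth_mono[of ?xs m i] i lt a by auto
        then show "a \<in> (\<lambda>i. ?xs ! i) ` {..<m}" using i by auto
      qed
      then have "card (A \<inter> {..?ys ! m}) \<le> m"
        using surj_card_le[of "{..<m}"] by simp
      ultimately show False using le by (metis not_less_eq_eq order_trans)
    qed
    then show "list_all2 (\<le>) ?xs ?ys" using card by (simp add: list_all2_conv_all_nth)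
  qed
qed

definition triangle_row :: "int mat \<Rightarrow> nat \<Rightarrow> nat set" where
  "triangle_row X k = {Suc j | j. j < dim_col X \<and> (\<Sum>a<k. X $$ (a, j)) = 1}"

lemma finite_triangle_row [simp]: "finite (triangle_row X k)"
  by (rule finite_subset[of _ "Suc ` {..<dim_col X}"]) (auto simp: triangle_row_def)

text \<open>The sum of the first \<open>k\<close> rows has entries in \<open>{0, 1}\<close>, so counting the ones among its first \<open>t\<close>
  entries is the same as adding up these entries.\<close>

lemma card_triangle_row:
  assumes X: "X \<in> ASMs n" and "k \<le> n" "t \<le> n"
  shows "int (card (triangle_row X k \<inter> {..t})) = corner_sum X k t"
proof -
  have X': "X \<in> carrier_mat n n" using X by (simp add: ASMs_def)
  then have c: "corner_sum_function n (corner_sum X)"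
    using X ASMs_iff_corner_sum_function by blast
  have "triangle_row X k \<inter> {..t} = Suc ` ({..<t} \<inter> {j. (\<Sum>a<k. X $$ (a, j)) = 1})"
    using assms(3) X' by (auto simp: triangle_row_def)
  then have "int (card (triangle_row X k \<inter> {..t})) =
      int (card ({..<t} \<inter> {j. (\<Sum>a<k. X $$ (a, j)) = 1}))"
    by (simp add: card_image)
  also have "\<dots> = (\<Sum>j<t. if (\<Sum>a<k. X $$ (a, j)) = 1 then 1 else 0)"
    by (simp add: sum.If_cases)
  also have "\<dots> = (\<Sum>j<t. \<Sum>a<k. X $$ (a, j))"
  proof (intro sum.cong refl)
    fix j assume "j \<in> {..<t}"
    then have "corner_sum X k (Suc j) - corner_sum X k j \<in> {0, 1}"
      using c assms(2,3) unfolding corner_sum_function_def by auto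
    then show "(if (\<Sum>a<k. X $$ (a, j)) = 1 then 1 else 0) = (\<Sum>a<k. X $$ (a, j))"
      unfolding corner_sum_col_step by auto
  qed
  finally show ?thesis by (simp add: corner_sum_swap)
qed

lemma triangle_row_Int_atMost:
  assumes "X \<in> ASMs n"
  shows "triangle_row X k \<inter> {..t} = triangle_row X k \<inter> {..min t n}"
  using assms by (auto simp: triangle_row_def ASMs_def)

text \<open>In each row the thresholds \<open>t > n\<close> give the same count as \<open>n\<close>; the missing row \<open>k = 0\<close> of the
  triangle corresponds to corner sums that vanish.\<close>

lemma monotone_triangle_le_iff:
  assumes X: "X \<in> ASMs n" and Y: "Y \<in> ASMs n"
  shows "monotone_triangle_le X Y \<longleftrightarrow> (\<forall>k\<le>n. \<forall>t\<le>n. corner_sum Y k t \<le> corner_sum X k t)"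
proof -
  have n: "dim_row X = n" "dim_row Y = n" using X Y by (auto simp: ASMs_def)
  have row: "list_all2 (\<le>) (sorted_list_of_set (triangle_row X k))
        (sorted_list_of_set (triangle_row Y k)) \<longleftrightarrow>
      (\<forall>t\<le>n. corner_sum Y k t \<le> corner_sum X k t)" if k: "k \<le> n" for k
  proof -
    have full: "int (card (triangle_row Z k)) = int k" if Z: "Z \<in> ASMs n" for Z
    proof -
      have "corner_sum_function n (corner_sum Z)"
        using Z ASMs_iff_corner_sum_function by (auto simp: ASMs_def)
      then have "corner_sum Z k n = int k" using k unfolding corner_sum_function_def by blast
      moreover have "triangle_row Z k \<inter> {..n} = triangle_row Z k"
        using Z by (auto simp: triangle_row_def ASMs_def)
      ultimately show ?thesis using card_triangle_row[OF Z k order_refl] by simp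
    qed
    have "card (triangle_row X k) = card (triangle_row Y k)" using full[OF X] full[OF Y] by simp
    then have "list_all2 (\<le>) (sorted_list_of_set (triangle_row X k))
        (sorted_list_of_set (triangle_row Y k)) \<longleftrightarrow>
        (\<forall>t. card (triangle_row Y k \<inter> {..t}) \<le> card (triangle_row X k \<inter> {..t}))"
      by (intro sorted_list_of_set_le_iff_card) auto
    also have "\<dots> \<longleftrightarrow> (\<forall>t\<le>n. card (triangle_row Y k \<inter> {..t}) \<le> card (triangle_row X k \<inter> {..t}))"
      using triangle_row_Int_atMost[OF X] triangle_row_Int_atMost[OF Y] by (metis min.cobounded2)
    also have "\<dots> \<longleftrightarrow> (\<forall>t\<le>n. corner_sum Y k t \<le> corner_sum X k t)"
      using card_triangle_row[OF X k] card_triangle_row[OF Y k] by (metis of_nat_le_iff)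
    finally show ?thesis .
  qed
  have "monotone_triangle_le X Y \<longleftrightarrow> (\<forall>k\<in>{1..n}. list_all2 (\<le>)
      (sorted_list_of_set (triangle_row X k)) (sorted_list_of_set (triangle_row Y k)))"
    unfolding monotone_triangle_le_def monotone_triangle_def n triangle_row_def[symmetric]
      list.rel_map list_all2_same by auto
  also have "\<dots> \<longleftrightarrow> (\<forall>k\<in>{1..n}. \<forall>t\<le>n. corner_sum Y k t \<le> corner_sum X k t)"
    using row by auto
  also have "\<dots> \<longleftrightarrow> (\<forall>k\<le>n. \<forall>t\<le>n. corner_sum Y k t \<le> corner_sum X k t)"
    by (auto simp: corner_sum_def Suc_le_eq)
  finally show ?thesis .
qed

lemma WT_le_iff:
  assumes X: "X \<in> ASMs n" and Y: "Y \<in> ASMs n"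
  shows "(\<forall>i<n - 1. \<forall>j<n - 1. WT X $$ (i, j) \<le> WT Y $$ (i, j)) \<longleftrightarrow>
    (\<forall>k\<le>n. \<forall>t\<le>n. corner_sum Y k t \<le> corner_sum X k t)"
proof
  assume le: "\<forall>i<n - 1. \<forall>j<n - 1. WT X $$ (i, j) \<le> WT Y $$ (i, j)"
  have border_le: "zero_border n (WT X) k t \<le> zero_border n (WT Y) k t" for k t
  proof (cases "0 < k \<and> k < n \<and> 0 < t \<and> t < n")
    case True
    then have "k - 1 < n - 1" "t - 1 < n - 1" by auto
    then show ?thesis using le True by (simp add: zero_border_def)
  qed (auto simp: zero_border_def)
  show "\<forall>k\<le>n. \<forall>t\<le>n. corner_sum Y k t \<le> corner_sum X k t"
  proof (intro allI impI)
    fix k t assume "k \<le> n" "t \<le> n"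
    then show "corner_sum Y k t \<le> corner_sum X k t"
      using border_le[of k t] by (simp add: zero_border_WT[OF X] zero_border_WT[OF Y])
  qed
qed (simp add: WT_corner_sum[OF X] WT_corner_sum[OF Y])

theorem theorem10:
  fixes n :: nat
  assumes "n \<ge> 2"
  shows "WT ` ASMs n =
      {M \<in> carrier_mat (n - 1) (n - 1).
         \<forall>k<n - 1. row M k \<in> UM_vectors n \<and> col M k \<in> UM_vectors n \<and>
           (\<forall>i<n - 1. M $$ (k, i) \<le> M $$ (k, k) \<and> M $$ (i, k) \<le> M $$ (k, k))}
    \<and> (\<forall>X\<in>ASMs n. \<forall>Y\<in>ASMs n.
         (\<forall>i<n - 1. \<forall>j<n - 1. WT X $$ (i, j) \<le> WT Y $$ (i, j)) \<longleftrightarrow> monotone_triangle_le X Y)"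
proof (rule conjI)
  have "(\<forall>p. 0 < p \<and> p < n \<longrightarrow>
        unimodal_steps n p (\<lambda>i. zero_border n M i p) \<and> unimodal_steps n p (\<lambda>i. zero_border n M p i)) \<longleftrightarrow>
      (\<forall>k<n - 1. row M k \<in> UM_vectors n \<and> col M k \<in> UM_vectors n \<and>
           (\<forall>i<n - 1. M $$ (k, i) \<le> M $$ (k, k) \<and> M $$ (i, k) \<le> M $$ (k, k)))"
    (is "?L \<longleftrightarrow> ?R") if M: "M \<in> carrier_mat (n - 1) (n - 1)" for M
  proof -
    have d: "dim_row M = n - 1" "dim_col M = n - 1" using M by auto
    have "?L \<longleftrightarrow> (\<forall>k<n - 1. unimodal_steps n (Suc k) (\<lambda>i. zero_border n M i (Suc k)) \<and>
        unimodal_steps n (Suc k) (\<lambda>i. zero_border n M (Suc k) i))"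
    proof (intro iffI allI impI)
      fix p
      assume "\<forall>k<n - 1. unimodal_steps n (Suc k) (\<lambda>i. zero_border n M i (Suc k)) \<and>
        unimodal_steps n (Suc k) (\<lambda>i. zero_border n M (Suc k) i)" and p: "0 < p \<and> p < n"
      moreover have "p - 1 < n - 1" "Suc (p - 1) = p" using p by auto
      ultimately show "unimodal_steps n p (\<lambda>i. zero_border n M i p) \<and>
          unimodal_steps n p (\<lambda>i. zero_border n M p i)"
        by metis
    qed simp
    also have "\<dots> \<longleftrightarrow> ?R"
    proof (intro all_cong)
      fix k assume k: "k < n - 1"
      then show "unimodal_steps n (Suc k) (\<lambda>i. zero_border n M i (Suc k)) \<and>
          unimodal_steps n (Suc k) (\<lambda>i. zero_border n M (Suc k) i) \<longleftrightarrow>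
          row M k \<in> UM_vectors n \<and> col M k \<in> UM_vectors n \<and>
           (\<forall>i<n - 1. M $$ (k, i) \<le> M $$ (k, k) \<and> M $$ (i, k) \<le> M $$ (k, k))"
        using UM_with_maximum_iff[of "Suc k" n "col M k"] UM_with_maximum_iff[of "Suc k" n "row M k"]
          zero_border_vec_row_col[OF M, of "Suc k"] d by auto
    qed
    finally show ?thesis .
  qed
  then show "WT ` ASMs n =
      {M \<in> carrier_mat (n - 1) (n - 1).
         \<forall>k<n - 1. row M k \<in> UM_vectors n \<and> col M k \<in> UM_vectors n \<and>
           (\<forall>i<n - 1. M $$ (k, i) \<le> M $$ (k, k) \<and> M $$ (i, k) \<le> M $$ (k, k))}"
    unfolding set_eq_iff WT_image_iff mem_Collect_eq by (intro allI conj_cong refl)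
next
  show "\<forall>X\<in>ASMs n. \<forall>Y\<in>ASMs n.
         (\<forall>i<n - 1. \<forall>j<n - 1. WT X $$ (i, j) \<le> WT Y $$ (i, j)) \<longleftrightarrow> monotone_triangle_le X Y"
    by (intro ballI) (simp only: WT_le_iff monotone_triangle_le_iff)
qed

end
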